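(* Let $p\ge0$, $q\ge0$, $m\ge0$ be integers and let $f,g,h$ be entire functions represented by vector valued Dirichlet series such that $f$ has relative index-pair $(m,q)$ and $g$ has relative index-pair $(m,p)$ with respect to $h$. Suppose $\lambda_h^{(m,q)}(f)=\rho_h^{(m,q)}(f)$. Then $$\left[\frac{\overline{\Delta}_h^{(m,q)}(f)}{\Delta_h^{(m,p)}(g)}\right]^{\frac{1}{\rho_h^{(m,p)}(g)}}\le\tau_g^{(p,q)}(f)\le\min\left\{\left[\frac{\overline{\Delta}_h^{(m,q)}(f)}{\overline{\Delta}_h^{(m,p)}(g)}\right]^{\frac{1}{\rho_h^{(m,p)}(g)}},\left[\frac{\Delta_h^{(m,q)}(f)}{\Delta_h^{(m,p)}(g)}\right]^{\frac{1}{\rho_h^{(m,p)}(g)}}\right\}$$ $$\le\max\left\{\left[\frac{\overline{\Delta}_h^{(m,q)}(f)}{\overline{\Delta}_h^{(m,p)}(g)}\right]^{\frac{1}{\rho_h^{(m,p)}(g)}},\left[\frac{\Delta_h^{(m,q)}(f)}{\Delta_h^{(m,p)}(g)}\right]^{\frac{1}{\rho_h^{(m,p)}(g)}}\right\}\le\overline{\tau}_g^{(p,q)}(f)\le\left[\frac{\Delta_h^{(m,q)}(f)}{\overline{\Delta}_h^{(m,p)}(g)}\right]^{\frac{1}{\rho_h^{(m,p)}(g)}}$$ and $$\left[\frac{\tau_h^{(m,q)}(f)}{\overline{\tau}_h^{(m,p)}(g)}\right]^{\frac{1}{\lambda_h^{(m,p)}(g)}}\le\overline{\Delta}_g^{(p,q)}(f)\le\min\left\{\left[\frac{\tau_h^{(m,q)}(f)}{\tau_h^{(m,p)}(g)}\right]^{\frac{1}{\lambda_h^{(m,p)}(g)}},\left[\frac{\overline{\tau}_h^{(m,q)}(f)}{\overline{\tau}_h^{(m,p)}(g)}\right]^{\frac{1}{\lambda_h^{(m,p)}(g)}}\right\}$$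 $$\le\max\left\{\left[\frac{\tau_h^{(m,q)}(f)}{\tau_h^{(m,p)}(g)}\right]^{\frac{1}{\lambda_h^{(m,p)}(g)}},\left[\frac{\overline{\tau}_h^{(m,q)}(f)}{\overline{\tau}_h^{(m,p)}(g)}\right]^{\frac{1}{\lambda_h^{(m,p)}(g)}}\right\}\le\Delta_g^{(p,q)}(f)\le\left[\frac{\overline{\tau}_h^{(m,q)}(f)}{\tau_h^{(m,p)}(g)}\right]^{\frac{1}{\lambda_h^{(m,p)}(g)}}.$$
   Context: VVDS: an entire function represented by a vector valued Dirichlet series is a function $f(s)=\sum_{n\ge1}a_ne^{s\lambda_n}$, $s=\sigma+it$, not identically zero, with $a_n$ in a complex Banach space $(E,\|\cdot\|)$, $0<\lambda_n<\lambda_{n+1}$, $\lambda_n\to+\infty$, $\limsup_{n}\frac{\log n}{\lambda_n}<+\infty$ and $\limsup_{n}\frac{\log\|a_n\|}{\lambda_n}=-\infty$ (so the series converges absolutely everywhere). Its maximum modulus is $M_f(\sigma)=\sup_{t\in\mathbb R}\|f(\sigma+it)\|$, and $M_f^{-1}$ is the inverse function of $M_f$. Iterated logarithms: $\log^{[0]}x=x$, $\log^{[-1]}x=\exp x$, $\log^{[k]}x=\log(\log^{[k-1]}x)$ for $k\ge1$. Index-pair: for $k\ge q+1\ge1$ let $\rho_f(k,q)=\limsup_{\sigma\to+\infty}\frac{\log^{[k]}M_f(\sigma)}{\log^{[q]}\sigma}$ (the same formula is used for shifted indices). $f$ has index-pair $(1,1)$ if $0<\rho_f(1,1)<\infty$;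 otherwise $f$ has index-pair $(k,q)\neq(1,1)$, $k\ge q+1\ge1$, if $\delta_{k-q,0}<\rho_f(k,q)<\infty$ and $\rho_f(k-1,q-1)$ is not a positive real number, where $\delta_{i,j}=1$ if $i=j$ and $0$ otherwise. Relative Ritt orders: if $f$ and $g$ have index-pairs $(k,q)$ and $(k,p)$ with $k\ge q+1\ge1$, $k\ge p+1\ge1$, then $$\rho_g^{(p,q)}(f)=\limsup_{\sigma\to+\infty}\frac{\log^{[p]}M_g^{-1}(M_f(\sigma))}{\log^{[q]}\sigma},\qquad \lambda_g^{(p,q)}(f)=\liminf_{\sigma\to+\infty}\frac{\log^{[p]}M_g^{-1}(M_f(\sigma))}{\log^{[q]}\sigma}$$ are the $(p,q)$-th relative Ritt order and lower order of $f$ with respect to $g$. In this situation $f$ has relative index-pair $(p,q)$ with respect to $g$ if $b<\rho_g^{(p,q)}(f)<\infty$ and $\rho_g^{(p-1,q-1)}(f)$ (same formula) is not a nonzero finite number, where $b=1$ if $p=q=k$ and $b=0$ otherwise. Relative types: if $0<\rho_g^{(p,q)}(f)<\infty$, the relative Ritt type $\Delta_g^{(p,q)}(f)$ and lower type $\overline{\Delta}_g^{(p,q)}(f)$ are respectively the $\limsup$ and the $\liminf$ as $\sigma\to+\infty$ of $$\frac{\log^{[p-1]}M_g^{-1}(M_f(\sigma))}{[\log^{[q-1]}\sigma]^{\rho_g^{(p,q)}(f)}}.$$ If $0<\lambda_g^{(p,q)}(f)<\infty$, the relative Ritt weak type $\tau_g^{(p,q)}(f)$ and the indicator $\overline{\tau}_g^{(p,q)}(f)$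 are respectively the $\liminf$ and the $\limsup$ as $\sigma\to+\infty$ of $$\frac{\log^{[p-1]}M_g^{-1}(M_f(\sigma))}{[\log^{[q-1]}\sigma]^{\lambda_g^{(p,q)}(f)}}.$$ For other pairs of functions and indices the definitions are the same with the letters changed. The claim presupposes that all quantities appearing in it are defined, i.e. the corresponding orders or lower orders are positive and finite. Convention: types lie in $[0,\infty]$; quotients are taken with $a/0=\infty$ for $a>0$ and $a/\infty=0$ for $a<\infty$, and relations are asserted when every quotient is meaningful (no $0/0$ or $\infty/\infty$). *)

theory Defs
  imports "HOL-Analysis.Analysis"
begin

(* HOL-Analysis only provides real Banach spaces (class banach); here the norm is required to be
   homogeneous over the complex scalars, and the complex action to extend the real one. *)
class complex_banach = banach +
  fixes scaleC :: "complex \<Rightarrow> 'a \<Rightarrow> 'a"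
  assumes scaleC_add_right: "scaleC c (x + y) = scaleC c x + scaleC c y"
    and scaleC_add_left: "scaleC (c + d) x = scaleC c x + scaleC d x"
    and scaleC_scaleC: "scaleC c (scaleC d x) = scaleC (c * d) x"
    and scaleC_of_real: "scaleC (complex_of_real r) x = r *\<^sub>R x"
    and norm_scaleC: "norm (scaleC c x) = cmod c * norm x"

instantiation complex :: complex_banach
begin

definition scaleC_complex :: "complex \<Rightarrow> complex \<Rightarrow> complex"
  where "scaleC_complex c z = c * z"

instance
  by standard (auto simp: scaleC_complex_def algebra_simps norm_mult scaleR_conv_of_real)

end

(* The index n of the series starts at 1, so l 0 and a 0 are irrelevant.
   Vanishing coefficients are allowed: log 0 is read as -\<infinity>. *)
definition entire_vvds :: "(complex \<Rightarrow> 'a::complex_banach) \<Rightarrow> bool"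
  where "entire_vvds f \<longleftrightarrow>
    (\<exists>(a :: nat \<Rightarrow> 'a) (l :: nat \<Rightarrow> real).
       (\<forall>n\<ge>1. 0 < l n \<and> l n < l (Suc n)) \<and>
       filterlim l at_top sequentially \<and>
       limsup (\<lambda>n. ereal (ln (real n) / l n)) < \<infinity> \<and>
       limsup (\<lambda>n. if a n = 0 then -\<infinity> else ereal (ln (norm (a n)) / l n)) = -\<infinity> \<and>
       (\<forall>s. (\<lambda>n. scaleC (exp (s * complex_of_real (l (Suc n)))) (a (Suc n))) sums f s)) \<and>
    (\<exists>s. f s \<noteq> 0)"

definition max_modulus :: "(complex \<Rightarrow> 'a::complex_banach) \<Rightarrow> real \<Rightarrow> real"
  where "max_modulus f \<sigma> = (SUP t. norm (f (Complex \<sigma> t)))"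

(* The iterated logarithm of order k. For negative k this iterates exp, so that order -1 is exp.
   Where ln is applied to a nonpositive number the value is a junk value; all uses below are
   limits along arguments tending to infinity, where this does not happen. *)
definition iter_log :: "int \<Rightarrow> real \<Rightarrow> real"
  where "iter_log k x = (if 0 \<le> k then (ln ^^ nat k) x else (exp ^^ nat (- k)) x)"

definition pos_finite :: "ereal \<Rightarrow> bool"
  where "pos_finite x \<longleftrightarrow> 0 < x \<and> x < \<infinity>"

definition ritt_order :: "(complex \<Rightarrow> 'a::complex_banach) \<Rightarrow> int \<Rightarrow> int \<Rightarrow> ereal"
  where "ritt_order f k q =
    Limsup at_top (\<lambda>\<sigma>. ereal (iter_log k (max_modulus f \<sigma>) / iter_log q \<sigma>))"

definition has_index_pair :: "(complex \<Rightarrow> 'a::complex_banach) \<Rightarrow> int \<Rightarrow> int \<Rightarrow> bool"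
  where "has_index_pair f k q \<longleftrightarrow>
    (if pos_finite (ritt_order f 1 1) then k = 1 \<and> q = 1
     else (k, q) \<noteq> (1, 1) \<and> q + 1 \<le> k \<and> 1 \<le> q + 1 \<and>
          (if k - q = 0 then 1 else 0) < ritt_order f k q \<and> ritt_order f k q < \<infinity> \<and>
          \<not> pos_finite (ritt_order f (k - 1) (q - 1)))"

(* In all relative notions the first argument g is the function with respect to which the
   growth of the second argument f is measured. *)
definition rel_modulus ::
    "(complex \<Rightarrow> 'b::complex_banach) \<Rightarrow> (complex \<Rightarrow> 'a::complex_banach) \<Rightarrow> real \<Rightarrow> real"
  where "rel_modulus g f \<sigma> = inv (max_modulus g) (max_modulus f \<sigma>)"

definition rel_order ::
    "(complex \<Rightarrow> 'b::complex_banach) \<Rightarrow> (complex \<Rightarrow> 'a::complex_banach) \<Rightarrow> int \<Rightarrow> int \<Rightarrow> ereal"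
  where "rel_order g f p q =
    Limsup at_top (\<lambda>\<sigma>. ereal (iter_log p (rel_modulus g f \<sigma>) / iter_log q \<sigma>))"

definition rel_lower_order ::
    "(complex \<Rightarrow> 'b::complex_banach) \<Rightarrow> (complex \<Rightarrow> 'a::complex_banach) \<Rightarrow> int \<Rightarrow> int \<Rightarrow> ereal"
  where "rel_lower_order g f p q =
    Liminf at_top (\<lambda>\<sigma>. ereal (iter_log p (rel_modulus g f \<sigma>) / iter_log q \<sigma>))"

definition has_rel_index_pair ::
    "(complex \<Rightarrow> 'b::complex_banach) \<Rightarrow> (complex \<Rightarrow> 'a::complex_banach) \<Rightarrow> int \<Rightarrow> int \<Rightarrow> bool"
  where "has_rel_index_pair g f p q \<longleftrightarrow>
    (\<exists>k. q + 1 \<le> k \<and> 1 \<le> q + 1 \<and> p + 1 \<le> k \<and> 1 \<le> p + 1 \<and>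
         has_index_pair f k q \<and> has_index_pair g k p \<and>
         (if p = q \<and> q = k then 1 else 0) < rel_order g f p q \<and> rel_order g f p q < \<infinity> \<and>
         \<not> (rel_order g f (p - 1) (q - 1) \<noteq> 0 \<and> \<bar>rel_order g f (p - 1) (q - 1)\<bar> \<noteq> \<infinity>))"

definition type_quotient ::
    "(complex \<Rightarrow> 'b::complex_banach) \<Rightarrow> (complex \<Rightarrow> 'a::complex_banach) \<Rightarrow> int \<Rightarrow> int \<Rightarrow> ereal
      \<Rightarrow> real \<Rightarrow> ereal"
  where "type_quotient g f p q r \<sigma> =
    ereal (iter_log (p - 1) (rel_modulus g f \<sigma>) / iter_log (q - 1) \<sigma> powr real_of_ereal r)"

(* The types below are meaningful only if the order used as exponent is positive and finite. *)
definition rel_type ::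
    "(complex \<Rightarrow> 'b::complex_banach) \<Rightarrow> (complex \<Rightarrow> 'a::complex_banach) \<Rightarrow> int \<Rightarrow> int \<Rightarrow> ereal"
  where "rel_type g f p q = Limsup at_top (type_quotient g f p q (rel_order g f p q))"

definition rel_lower_type ::
    "(complex \<Rightarrow> 'b::complex_banach) \<Rightarrow> (complex \<Rightarrow> 'a::complex_banach) \<Rightarrow> int \<Rightarrow> int \<Rightarrow> ereal"
  where "rel_lower_type g f p q = Liminf at_top (type_quotient g f p q (rel_order g f p q))"

definition rel_weak_type ::
    "(complex \<Rightarrow> 'b::complex_banach) \<Rightarrow> (complex \<Rightarrow> 'a::complex_banach) \<Rightarrow> int \<Rightarrow> int \<Rightarrow> ereal"
  where "rel_weak_type g f p q = Liminf at_top (type_quotient g f p q (rel_lower_order g f p q))"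

definition rel_upper_weak_type ::
    "(complex \<Rightarrow> 'b::complex_banach) \<Rightarrow> (complex \<Rightarrow> 'a::complex_banach) \<Rightarrow> int \<Rightarrow> int \<Rightarrow> ereal"
  where "rel_upper_weak_type g f p q =
    Limsup at_top (type_quotient g f p q (rel_lower_order g f p q))"

(* The quotient a / b of elements of [0, \<infinity>] is neither 0/0 nor \<infinity>/\<infinity>. For the remaining pairs the
   division of ereal follows the convention a/0 = \<infinity> (a > 0) and a/\<infinity> = 0 (a < \<infinity>). *)
definition quotient_ok :: "ereal \<Rightarrow> ereal \<Rightarrow> bool"
  where "quotient_ok a b \<longleftrightarrow> \<not> (a = 0 \<and> b = 0) \<and> \<not> (a = \<infinity> \<and> b = \<infinity>)"

(* (a / b) raised to the power 1 / r, for a, b in [0, \<infinity>] and 0 < r < \<infinity> *)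
definition quotient_root :: "ereal \<Rightarrow> ereal \<Rightarrow> ereal \<Rightarrow> ereal"
  where "quotient_root a b r =
    (if a / b = \<infinity> then \<infinity> else ereal (real_of_ereal (a / b) powr (1 / real_of_ereal r)))"

end

theory Submission
  imports Defs
begin

text \<open>
  Write \<open>F = M\<^sub>h\<inverse> \<circ> M\<^sub>f\<close>, \<open>G = M\<^sub>h\<inverse> \<circ> M\<^sub>g\<close> and \<open>R = M\<^sub>g\<inverse> \<circ> M\<^sub>f\<close>, so that \<open>F = G \<circ> R\<close>. Since \<open>R\<close> is
  invertible near infinity, limits superior and inferior along \<open>R \<sigma>\<close> agree with those along \<open>\<sigma>\<close>.
  Dividing the order quotient of \<open>F\<close>, which converges, by that of \<open>G\<close> at \<open>R \<sigma>\<close> shows that the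
  lower order (order) of \<open>f\<close> relative to \<open>g\<close> is \<open>\<alpha> / \<beta>\<close>, where \<open>\<alpha>\<close> is the order of \<open>f\<close> and \<open>\<beta>\<close> the order
  (lower order) of \<open>g\<close> relative to \<open>h\<close>. With this exponent the type quotient of \<open>R\<close> is the
  \<open>1 / \<beta>\<close>-th power of the type quotient of \<open>F\<close> divided by that of \<open>G\<close> at \<open>R \<sigma>\<close>, and all bounds
  follow from those for the limits inferior and superior of a quotient.

  That the inverses behave as expected rests on the convexity of the maximum modulus. Averaging
  over the points \<open>s \<plusminus> r\<close>, \<open>s \<plusminus> ir\<close> reproduces \<open>f s\<close> up to \<open>O(r\<^sup>4)\<close>, so the second differences
  of \<open>M\<^sub>f\<close> are at least \<open>- C r\<^sup>4\<close>. As \<open>M\<^sub>f\<close> is convex and tends to \<open>0\<close> at \<open>-\<infinity>\<close>, it is strictly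
  increasing where it is positive, and it is unbounded.
\<close>

subsection \<open>Convex functions of a real variable\<close>

text \<open>Adding a small convex parabola to the difference of \<open>M\<close> and a chord makes the second
  difference strictly positive, which excludes interior maxima.\<close>
lemma convex_on_second_difference:
  fixes M :: "real \<Rightarrow> real"
  assumes cont: "continuous_on UNIV M"
    and diff: "\<And>x e. e > 0 \<Longrightarrow>
      eventually (\<lambda>r. - e * r\<^sup>2 \<le> M (x + r) + M (x - r) - 2 * M x) (at_right 0)"
  shows "convex_on UNIV M"
proof (rule convex_on_linorderI)
  fix t a b :: real
  assume t: "0 < t" "t < 1" and ab: "a < b"
  define c where "c = (1 - t) * a + t * b"
  have ca: "c - a = t * (b - a)" and cb: "b - c = (1 - t) * (b - a)"
    by (simp_all add: c_def algebra_simps)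
  then have c: "a < c" "c < b"
    using t ab by (smt (verit) mult_pos_pos)+
  define k where "k = (M b - M a) / (b - a)"
  have kb: "k * (b - a) = M b - M a"
    using ab by (simp add: k_def)
  have "M c \<le> M a + k * (c - a)"
  proof (rule ccontr)
    assume "\<not> ?thesis"
    then have gap: "M c - M a - k * (c - a) > 0" by simp
    \<comment> \<open>The parabola removes half of the gap at \<open>c\<close> and vanishes at
      \<open>a\<close> and \<open>b\<close>, so \<open>D c\<close> stays positive while
      \<open>D\<close> is zero at both ends.\<close>
    define e where "e = (M c - M a - k * (c - a)) / 2 / ((c - a) * (b - c))"
    have e: "e > 0" "e * ((c - a) * (b - c)) = (M c - M a - k * (c - a)) / 2"
      using gap c by (simp_all add: e_def)
    define D where "D x = M x - M a - k * (x - a) + e * ((x - a) * (x - b))" for x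
    have "continuous_on {a..b} D"
      unfolding D_def by (intro continuous_intros continuous_on_subset[OF cont]) auto
    then obtain z where z: "z \<in> {a..b}" "\<And>y. y \<in> {a..b} \<Longrightarrow> D y \<le> D z"
      using continuous_attains_sup[of "{a..b}" D] ab by (auto simp: Ball_def)
    have "D c > 0"
      using e gap by (simp add: D_def algebra_simps)
    then have "D z > 0" using z(2)[of c] c by simp
    moreover have "D a = 0" "D b = 0" using kb by (simp_all add: D_def)
    ultimately have "z \<noteq> a" "z \<noteq> b" by auto
    then have zin: "a < z" "z < b" using z(1) by auto
    have "eventually (\<lambda>r. r \<in> {0<..<min (z - a) (b - z)}) (at_right 0)"
      by (rule eventually_at_right_real) (use zin in simp)
    then have "eventually (\<lambda>r. False) (at_right (0::real))"
      using diff[OF e(1), of z]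
    proof eventually_elim
      case (elim r)
      then have "D (z + r) \<le> D z" "D (z - r) \<le> D z" by (auto intro!: z(2))
      \<comment> \<open>The parabola contributes \<open>2 * (e * r\<^sup>2)\<close>, more than the
        loss \<open>e * r\<^sup>2\<close> allowed by \<open>diff\<close>, so the second difference
        at the maximum \<open>z\<close> would be positive.\<close>
      moreover have "D (z + r) + D (z - r) - 2 * D z =
          M (z + r) + M (z - r) - 2 * M z + 2 * (e * r\<^sup>2)"
        by (simp add: D_def algebra_simps power2_eq_square)
      moreover have "e * r\<^sup>2 > 0" using e(1) elim by simp
      ultimately show False using elim by simp
    qed
    then show False by simp
  qed
  also have "k * (c - a) = t * (M b - M a)"
    using kb by (simp add: ca mult.left_commute)
  finally show "M ((1 - t) *\<^sub>R a + t *\<^sub>R b) \<le> (1 - t) * M a + t * M b"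
    by (simp add: c_def algebra_simps)
qed simp

text \<open>Slopes of a convex function increase. As \<open>M\<close> tends to 0 on the left, some
  \<open>z < x\<close> has a smaller value, and the positive slope of the chord from
  \<open>z\<close> to \<open>x\<close> is a lower bound for the slopes of all chords from
  \<open>x\<close> to the right.\<close>

lemma convex_on_tendsto_0_at_bot_growth:
  fixes M :: "real \<Rightarrow> real"
  assumes conv: "convex_on UNIV M" and lim: "(M \<longlongrightarrow> 0) at_bot" and pos: "M x > 0"
  obtains k where "k > 0" "\<And>y. y > x \<Longrightarrow> M x + k * (y - x) \<le> M y"
proof -
  have "eventually (\<lambda>z. M z < M x \<and> z < x) at_bot"
    by (intro eventually_conj order_tendstoD(2)[OF lim pos] eventually_gt_at_bot)
  then obtain z where z: "M z < M x" "z < x"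
    by (metis (mono_tags, lifting) eventually_at_bot_linorder order_refl)
  define k where "k = (M x - M z) / (x - z)"
  have "M x + k * (y - x) \<le> M y" if "y > x" for y
  proof -
    have "(M x - M z) / (x - z) \<le> (M y - M x) / (y - x)"
    proof -
      have "(M z - M x) / (z - x) \<le> (M x - M y) / (x - y)"
        using convex_on_slope_le[OF conv, of z y x] z that by auto
      then show ?thesis by (metis minus_diff_eq minus_divide_divide)
    qed
    then show ?thesis using that by (simp add: k_def pos_le_divide_eq)
  qed
  moreover have "k > 0" using z by (simp add: k_def)
  ultimately show ?thesis using that by blast
qed

subsection \<open>The maximum modulus of a Dirichlet series\<close>

text \<open>The powers 1, 2 and 3 sum to zero over the fourth roots of unity, so only four cubic
  Taylor remainders are left, each at most \<open>x ^ 4 * exp x / 6\<close>.\<close>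

lemma four_point_exp_bound:
  fixes x :: real
  assumes "x \<ge> 0"
  shows "cmod (exp (of_real x) + exp (- of_real x) + exp (\<i> * of_real x) + exp (- (\<i> * of_real x)) - 4)
    \<le> x ^ 4 * exp x"
proof -
  define T where "T z = exp z - (\<Sum>k\<le>3. z ^ k / fact k)" for z :: complex
  have T: "cmod (T z) \<le> x ^ 4 * exp x / 6" if "cmod z = x" for z
    using Taylor_exp_field[of z 3] that by (simp add: T_def fact_numeral mult.commute)
  have "exp (of_real x) + exp (- of_real x) + exp (\<i> * of_real x) + exp (- (\<i> * of_real x)) - 4
      = T (of_real x) + T (- of_real x) + T (\<i> * of_real x) + T (- (\<i> * of_real x))"
    by (simp add: T_def atMost_nat_numeral fact_numeral power_mult_distrib field_simps power2_eq_square
        power3_eq_cube)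
  also have "cmod \<dots> \<le> cmod (T (of_real x)) + cmod (T (- of_real x)) + cmod (T (\<i> * of_real x))
      + cmod (T (- (\<i> * of_real x)))"
    by (intro order.trans[OF norm_triangle_ineq] add_mono order_refl)
  also have "\<dots> \<le> 4 * (x ^ 4 * exp x / 6)"
    using T[of "of_real x"] T[of "- of_real x"] T[of "\<i> * of_real x"] T[of "- (\<i> * of_real x)"] assms
    unfolding norm_minus_cancel norm_mult norm_ii norm_of_real by linarith
  also have "\<dots> \<le> x ^ 4 * exp x" using assms by simp
  finally show ?thesis .
qed

lemma scaleC_diff_left: "scaleC (c - d) x = scaleC c x - scaleC d x"
  using scaleC_add_left[of "c - d" d x] by simp

lemma norm_scaleC_sums_le:
  assumes "(\<lambda>n. scaleC (c n) (a n)) sums y" "\<And>n. cmod (c n) \<le> b n"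
    and "summable (\<lambda>n. norm (a n) * b n)"
  shows "norm y \<le> (\<Sum>n. norm (a n) * b n)"
proof -
  have le: "norm (scaleC (c n) (a n)) \<le> norm (a n) * b n" for n
    using mult_left_mono[OF assms(2)[of n] norm_ge_zero[of "a n"]] by (simp add: norm_scaleC mult.commute)
  have "summable (\<lambda>n. norm (scaleC (c n) (a n)))"
    by (rule summable_comparison_test'[OF assms(3), of 0]) (simp add: le)
  then have "norm y \<le> (\<Sum>n. norm (scaleC (c n) (a n)))"
    using summable_norm sums_unique[OF assms(1)] by fastforce
  also have "\<dots> \<le> (\<Sum>n. norm (a n) * b n)"
    by (rule suminf_le[OF le]) fact+
  finally show ?thesis .
qed

lemma power4_le_exp:
  fixes x :: real
  assumes "x \<ge> 0"
  shows "x ^ 4 \<le> 24 * exp x"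
proof -
  have "x ^ 4 / fact 4 \<le> exp x"
    using sum_le_suminf[of "\<lambda>n. x ^ n / fact n" "{4}"] assms
      exp_converges[of x] by (simp add: sums_iff divide_inverse mult.commute)
  then show ?thesis by (simp add: fact_numeral)
qed

text \<open>A mean value estimate, obtained from \<open>1 + w \<le> exp w\<close> at
  \<open>w = v - u\<close> after multiplication by \<open>exp u\<close>.\<close>

lemma abs_exp_diff_le:
  fixes x y K :: real
  assumes "x \<le> K" "y \<le> K"
  shows "\<bar>exp x - exp y\<bar> \<le> \<bar>x - y\<bar> * exp K"
proof -
  have *: "exp u - exp v \<le> (u - v) * exp K" if "v \<le> u" "u \<le> K" for u v :: real
  proof -
    have "exp u * (1 + (v - u)) \<le> exp u * exp (v - u)"
      by (intro mult_left_mono exp_ge_add_one_self) simp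
    then have "exp u - exp v \<le> (u - v) * exp u"
      by (simp add: algebra_simps flip: exp_add)
    also have "\<dots> \<le> (u - v) * exp K" using that by (intro mult_left_mono) auto
    finally show ?thesis .
  qed
  show ?thesis using *[of x y] *[of y x] assms by (cases "x \<le> y") auto
qed

section \<open>Continuity, convexity and decay of the maximum modulus\<close>

text \<open>Indices are shifted to start at 0, so \<open>l 0\<close> is the least exponent. The
  growth conditions enter as absolute convergence at every real \<open>x\<close>.\<close>

locale dirichlet_series =
  fixes a :: "nat \<Rightarrow> 'a::complex_banach" and l :: "nat \<Rightarrow> real" and f :: "complex \<Rightarrow> 'a"
  assumes l0_pos: "0 < l 0" and l0_le: "l 0 \<le> l n"
    and summable_norm_exp: "summable (\<lambda>n. norm (a n) * exp (x * l n))"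
    and sums: "(\<lambda>n. scaleC (exp (s * complex_of_real (l n))) (a n)) sums f s"
begin

definition majorant :: "real \<Rightarrow> real"
  where "majorant x = (\<Sum>n. norm (a n) * exp (x * l n))"

lemma l_pos: "0 < l n"
  using l0_pos l0_le by (rule less_le_trans)

lemma norm_le_majorant:
  assumes "(\<lambda>n. scaleC (c n) (a n)) sums y" "\<And>n. cmod (c n) \<le> k * exp (x * l n)"
  shows "norm y \<le> k * majorant x"
proof -
  have "norm y \<le> (\<Sum>n. norm (a n) * (k * exp (x * l n)))"
    using assms summable_mult[OF summable_norm_exp, of k x]
    by (intro norm_scaleC_sums_le[where c = c]) (simp_all add: mult.left_commute)
  also have "\<dots> = k * majorant x"
    using suminf_mult[OF summable_norm_exp, of k x] by (simp add: majorant_def mult.left_commute)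
  finally show ?thesis .
qed

lemma norm_f_le_majorant: "norm (f s) \<le> majorant (Re s)"
  using norm_le_majorant[OF sums[of s], of 1 "Re s"] by simp

lemma bdd_above_norm_f: "bdd_above (range (\<lambda>t. norm (f (Complex \<sigma> t))))"
  using norm_f_le_majorant[of "Complex \<sigma> _"] by (intro bdd_aboveI2[of _ _ "majorant \<sigma>"]) simp

lemma norm_f_le_max_modulus: "norm (f s) \<le> max_modulus f (Re s)"
  unfolding max_modulus_def using cSUP_upper[OF UNIV_I bdd_above_norm_f, of "Re s" "Im s"] by simp

lemma max_modulus_leI: "(\<And>t. norm (f (Complex \<sigma> t)) \<le> B) \<Longrightarrow> max_modulus f \<sigma> \<le> B"
  unfolding max_modulus_def by (rule cSUP_least) auto

lemma max_modulus_nonneg: "0 \<le> max_modulus f \<sigma>"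
  using order.trans[OF norm_ge_zero norm_f_le_max_modulus[of "Complex \<sigma> 0"]] by simp

lemma max_modulus_le_majorant: "max_modulus f \<sigma> \<le> majorant \<sigma>"
  using norm_f_le_majorant[of "Complex \<sigma> _"] by (intro max_modulus_leI) simp

text \<open>A Lipschitz bound uniform in the imaginary part. The mean value estimate produces a
  factor \<open>l n\<close>, which \<open>exp (l n)\<close> absorbs at the cost of moving the
  abscissa from \<open>K\<close> to \<open>K + 1\<close>.\<close>

lemma max_modulus_le_add:
  assumes "x \<le> K" "y \<le> K"
  shows "max_modulus f x \<le> max_modulus f y + \<bar>x - y\<bar> * majorant (K + 1)"
proof (rule max_modulus_leI)
  fix t
  have "norm (f (Complex x t) - f (Complex y t)) \<le> \<bar>x - y\<bar> * majorant (K + 1)"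
  proof (rule norm_le_majorant)
    show "(\<lambda>n. scaleC (exp (Complex x t * l n) - exp (Complex y t * l n)) (a n)) sums
        (f (Complex x t) - f (Complex y t))"
      unfolding scaleC_diff_left by (intro sums_diff sums)
    fix n
    \<comment> \<open>Both points have imaginary part \<open>t\<close>, so a common unimodular
      factor comes out and a difference of real exponentials remains.\<close>
    have eq: "exp (Complex u t * l n) = exp (u * l n) * exp (\<i> * (t * l n))" for u
      by (simp add: Complex_eq distrib_right exp_add mult.assoc exp_of_real flip: of_real_mult)
    have "cmod (exp (Complex x t * l n) - exp (Complex y t * l n)) = \<bar>exp (x * l n) - exp (y * l n)\<bar>"
      unfolding eq by (simp add: norm_mult flip: left_diff_distrib of_real_diff)
    also have "\<dots> \<le> \<bar>x * l n - y * l n\<bar> * exp (K * l n)"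
      using assms l_pos[of n] by (intro abs_exp_diff_le) auto
    also have "\<dots> = \<bar>x - y\<bar> * (l n * exp (K * l n))"
      using l_pos[of n] by (simp add: abs_mult flip: left_diff_distrib)
    also have "\<dots> \<le> \<bar>x - y\<bar> * (exp (l n) * exp (K * l n))"
      using exp_ge_add_one_self[of "l n"]
      by (intro mult_left_mono mult_right_mono order.strict_implies_order[OF exp_gt_zero] abs_ge_zero) linarith
    finally show "cmod (exp (Complex x t * l n) - exp (Complex y t * l n))
        \<le> \<bar>x - y\<bar> * exp ((K + 1) * l n)"
      by (simp add: distrib_right exp_add mult.commute[of "exp (l n)"])
  qed
  then show "norm (f (Complex x t)) \<le> max_modulus f y + \<bar>x - y\<bar> * majorant (K + 1)"
    using norm_f_le_max_modulus[of "Complex y t"]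
      norm_triangle_sub[of "f (Complex x t)" "f (Complex y t)"] by simp
qed

lemma isCont_max_modulus: "isCont (max_modulus f) x"
  unfolding isCont_def
proof (rule LIM_zero_cancel, rule Lim_null_comparison)
  have "eventually (\<lambda>y. y < x + 1) (at x)"
    by (intro order_tendstoD(2)[OF tendsto_ident_at]) simp
  then show "eventually (\<lambda>y. norm (max_modulus f y - max_modulus f x) \<le> \<bar>y - x\<bar> * majorant (x + 2)) (at x)"
  proof eventually_elim
    case (elim y)
    then show ?case
      using max_modulus_le_add[of y "x + 1" x] max_modulus_le_add[of x "x + 1" y]
      by (simp add: abs_le_iff abs_minus_commute add.assoc)
  qed
  have "((\<lambda>y. \<bar>y - x\<bar> * majorant (x + 2)) \<longlongrightarrow> \<bar>x - x\<bar> * majorant (x + 2)) (at x)"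
    by (intro tendsto_intros)
  then show "((\<lambda>y. \<bar>y - x\<bar> * majorant (x + 2)) \<longlongrightarrow> 0) (at x)" by simp
qed

text \<open>The first three Taylor terms cancel in the mean over the four points \<open>s \<plusminus> r\<close>, \<open>s \<plusminus> ir\<close>,
  and two of these points lie on the line of \<open>s\<close>.\<close>
lemma four_point_bound:
  assumes r: "0 < r" "r \<le> 1"
  shows "norm (f (s + r) + f (s - r) + f (s + \<i> * r) + f (s - \<i> * r) - f s - f s - f s - f s)
    \<le> 24 * r ^ 4 * majorant (Re s + 2)"
proof (rule norm_le_majorant)
  define e where "e z n = exp (z * complex_of_real (l n))" for z n
  show "(\<lambda>n. scaleC (e (s + r) n + e (s - r) n + e (s + \<i> * r) n + e (s - \<i> * r) n
        - e s n - e s n - e s n - e s n) (a n)) sums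
      (f (s + r) + f (s - r) + f (s + \<i> * r) + f (s - \<i> * r) - f s - f s - f s - f s)"
    unfolding scaleC_diff_left scaleC_add_left e_def by (intro sums_diff sums_add sums)
  fix n
  define x where "x = r * l n"
  have x: "x \<ge> 0" "x \<le> l n" using r l_pos[of n] by (simp_all add: x_def)
  have "e (s + r) n + e (s - r) n + e (s + \<i> * r) n + e (s - \<i> * r) n - e s n - e s n - e s n - e s n
      = e s n * (exp (of_real x) + exp (- of_real x) + exp (\<i> * of_real x) + exp (- (\<i> * of_real x)) - 4)"
    by (simp add: e_def x_def distrib_right left_diff_distrib exp_add exp_diff exp_minus field_simps)
  then have "cmod (e (s + r) n + e (s - r) n + e (s + \<i> * r) n + e (s - \<i> * r) n
        - e s n - e s n - e s n - e s n) \<le> exp (Re s * l n) * (x ^ 4 * exp x)"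
    using four_point_exp_bound[OF x(1)] by (simp add: norm_mult e_def)
  \<comment> \<open>The factors \<open>l n ^ 4\<close> and \<open>exp x\<close> cost one
    \<open>exp (l n)\<close> each, the latter because \<open>x \<le> l n\<close>; hence the shift of
    the abscissa by 2.\<close>
  also have "\<dots> \<le> exp (Re s * l n) * ((r ^ 4 * (24 * exp (l n))) * exp (l n))"
    using power4_le_exp[of "l n"] l_pos[of n] x r
    by (intro mult_left_mono mult_mono) (auto simp: x_def power_mult_distrib intro!: mult_left_mono)
  also have "\<dots> = 24 * r ^ 4 * (exp (Re s * l n) * (exp (l n) * exp (l n)))"
    by simp
  also have "exp (Re s * l n) * (exp (l n) * exp (l n)) = exp ((Re s + 2) * l n)"
    by (simp add: distrib_right flip: exp_add)
  finally show "cmod (e (s + r) n + e (s - r) n + e (s + \<i> * r) n + e (s - \<i> * r) n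
        - e s n - e s n - e s n - e s n) \<le> 24 * r ^ 4 * exp ((Re s + 2) * l n)" .
qed

text \<open>Two of the four points lie on the line of \<open>s\<close>, so the bound for
  \<open>4 * norm (f s)\<close> contains \<open>2 * max_modulus f x\<close>. Taking the supremum
  over \<open>t\<close> and subtracting leaves the second difference.\<close>

lemma max_modulus_second_difference:
  assumes r: "0 < r" "r \<le> 1"
  shows "- (24 * majorant (x + 2) * r ^ 4) \<le> max_modulus f (x + r) + max_modulus f (x - r) - 2 * max_modulus f x"
proof -
  have "max_modulus f x \<le> (max_modulus f (x + r) + max_modulus f (x - r) + 2 * max_modulus f x
      + 24 * r ^ 4 * majorant (x + 2)) / 4"
  proof (rule max_modulus_leI)
    fix t
    define s where "s = Complex x t"
    define E where "E = f (s + r) + f (s - r) + f (s + \<i> * r) + f (s - \<i> * r) - f s - f s - f s - f s"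
    have "4 *\<^sub>R f s = (1 + 1 + 1 + 1 :: real) *\<^sub>R f s" by simp
    also have "\<dots> = f s + f s + f s + f s" by (simp only: scaleR_left_distrib scaleR_one)
    also have "\<dots> = f (s + r) + f (s - r) + f (s + \<i> * r) + f (s - \<i> * r) - E"
      by (simp add: E_def algebra_simps)
    finally have "4 * norm (f s) = norm (f (s + r) + f (s - r) + f (s + \<i> * r) + f (s - \<i> * r) - E)"
      by (metis norm_scaleR abs_numeral)
    also have "\<dots> \<le> norm (f (s + r)) + norm (f (s - r)) + norm (f (s + \<i> * r)) + norm (f (s - \<i> * r)) + norm E"
      by (intro order.trans[OF norm_triangle_ineq4] order.trans[OF norm_triangle_ineq] add_mono order_refl)
    also have "\<dots> \<le> max_modulus f (x + r) + max_modulus f (x - r) + max_modulus f x + max_modulus f x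
        + 24 * r ^ 4 * majorant (x + 2)"
      using norm_f_le_max_modulus[of "s + r"] norm_f_le_max_modulus[of "s - r"]
        norm_f_le_max_modulus[of "s + \<i> * r"] norm_f_le_max_modulus[of "s - \<i> * r"]
        four_point_bound[OF r, of s]
      by (intro add_mono) (simp_all add: s_def E_def)
    finally show "norm (f (Complex x t)) \<le> (max_modulus f (x + r) + max_modulus f (x - r)
        + 2 * max_modulus f x + 24 * r ^ 4 * majorant (x + 2)) / 4"
      by (simp add: s_def)
  qed
  then show ?thesis by (simp add: mult_ac)
qed

lemma convex_max_modulus: "convex_on UNIV (max_modulus f)"
proof (rule convex_on_second_difference)
  show "continuous_on UNIV (max_modulus f)"
    using isCont_max_modulus by (simp add: continuous_at_imp_continuous_on)
  fix x e :: real
  assume e: "e > 0"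
  \<comment> \<open>The error of order \<open>r ^ 4\<close> is at most \<open>e * r\<^sup>2\<close>
    once \<open>24 * majorant (x + 2) * r\<^sup>2 < e\<close>.\<close>
  have "((\<lambda>r. 24 * majorant (x + 2) * r\<^sup>2) \<longlongrightarrow> 24 * majorant (x + 2) * 0\<^sup>2) (at_right 0)"
    by (intro tendsto_intros)
  then have "eventually (\<lambda>r. 24 * majorant (x + 2) * r\<^sup>2 < e) (at_right 0)"
    using e by (intro order_tendstoD) auto
  moreover have "eventually (\<lambda>r. r \<in> {0<..<1::real}) (at_right 0)"
    by (rule eventually_at_right_real) simp
  ultimately show "eventually (\<lambda>r. - e * r\<^sup>2 \<le> max_modulus f (x + r) + max_modulus f (x - r)
      - 2 * max_modulus f x) (at_right 0)"
  proof eventually_elim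
    case (elim r)
    have "24 * majorant (x + 2) * r ^ 4 = (24 * majorant (x + 2) * r\<^sup>2) * r\<^sup>2"
      by (simp add: power4_eq_xxxx power2_eq_square)
    also have "\<dots> \<le> e * r\<^sup>2" using elim by (intro mult_right_mono) auto
    finally show ?case using max_modulus_second_difference[of r x] elim by auto
  qed
qed

text \<open>All exponents are at least \<open>l 0\<close>, so for \<open>x \<le> 0\<close> the
  factor \<open>exp (l 0 * x)\<close> can be taken out of the majorant, leaving its value at
  0.\<close>

lemma max_modulus_at_bot: "(max_modulus f \<longlongrightarrow> 0) at_bot"
proof (rule tendsto_sandwich)
  show "eventually (\<lambda>x. 0 \<le> max_modulus f x) at_bot"
    by (simp add: max_modulus_nonneg)
  show "eventually (\<lambda>x. max_modulus f x \<le> exp (l 0 * x) * majorant 0) at_bot"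
    using eventually_le_at_bot[of 0]
  proof eventually_elim
    case (elim x)
    have "majorant x \<le> exp (l 0 * x) * majorant 0"
    proof -
      have "norm (a n) * exp (x * l n) \<le> exp (l 0 * x) * (norm (a n) * exp (0 * l n))" for n
        using mult_left_mono_neg[OF l0_le[of n] elim]
        by (simp add: mult.commute mult_left_mono)
      then have "majorant x \<le> (\<Sum>n. exp (l 0 * x) * (norm (a n) * exp (0 * l n)))"
        unfolding majorant_def by (intro suminf_le summable_mult summable_norm_exp)
      then show ?thesis unfolding majorant_def by (simp only: suminf_mult[OF summable_norm_exp])
    qed
    then show ?case using max_modulus_le_majorant[of x] by linarith
  qed
  have "filterlim (\<lambda>x. l 0 * x) at_bot at_bot"
    by (rule filterlim_tendsto_pos_mult_at_bot[OF tendsto_const l0_pos filterlim_ident])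
  then have "((\<lambda>x. exp (l 0 * x) * majorant 0) \<longlongrightarrow> 0 * majorant 0) at_bot"
    by (intro tendsto_mult tendsto_const filterlim_compose[OF exp_at_bot])
  then show "((\<lambda>x. exp (l 0 * x) * majorant 0) \<longlongrightarrow> 0) at_bot" by simp
qed simp

end

section \<open>Absolute convergence from the growth conditions, and growth at infinity\<close>

lemma entire_vvds_dirichlet_series:
  assumes "entire_vvds f"
  obtains a l where "dirichlet_series a l f"
proof -
  from assms obtain a l where l: "\<And>n. n \<ge> 1 \<Longrightarrow> 0 < l n \<and> l n < l (Suc n)"
    and lim1: "limsup (\<lambda>n. ereal (ln (real n) / l n)) < \<infinity>"
    and lim2: "limsup (\<lambda>n. if a n = 0 then -\<infinity> else ereal (ln (norm (a n)) / l n)) = -\<infinity>"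
    and sums: "\<And>s. (\<lambda>n. scaleC (exp (s * complex_of_real (l (Suc n)))) (a (Suc n))) sums f s"
    unfolding entire_vvds_def by blast
  have "l (Suc 0) \<le> l (Suc n)" for n
  proof (induction n)
    case (Suc n)
    then show ?case using l[of "Suc n"] by simp
  qed simp
  moreover have "summable (\<lambda>n. norm (a (Suc n)) * exp (x * l (Suc n)))" for x
  proof -
    obtain K where K: "limsup (\<lambda>n. ereal (ln (real n) / l n)) < ereal K"
      using ereal_dense2[OF lim1] by blast
    \<comment> \<open>The constant \<open>- (x + 2 * K)\<close> cancels \<open>exp (x * l n)\<close>
      and leaves \<open>exp (- 2 * (K * l n))\<close>, which is at most
      \<open>inverse (real n ^ 2)\<close> because \<open>ln n < K * l n\<close>.\<close>
    have "limsup (\<lambda>n. if a n = 0 then -\<infinity> else ereal (ln (norm (a n)) / l n)) < ereal (- (x + 2 * K))"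
      by (simp add: lim2)
    from Limsup_lessD[OF this] Limsup_lessD[OF K] eventually_ge_at_top[of 1]
    have "eventually (\<lambda>n. norm (norm (a n) * exp (x * l n)) \<le> inverse (real n ^ 2)) sequentially"
    proof eventually_elim
      case (elim n)
      have ln: "l n > 0" using l elim by simp
      show ?case
      proof (cases "a n = 0")
        case False
        have "norm (a n) = exp (ln (norm (a n)))" using False by simp
        also have "\<dots> \<le> exp (- (x + 2 * K) * l n)"
          using elim False ln unfolding exp_le_cancel_iff by (simp add: pos_divide_less_eq)
        finally have "norm (a n) * exp (x * l n) \<le> exp (- (x + 2 * K) * l n) * exp (x * l n)"
          by (rule mult_right_mono) simp
        also have "\<dots> = exp (- 2 * (K * l n))"
          by (simp add: algebra_simps flip: exp_add)
        also have "\<dots> \<le> exp (- 2 * ln (real n))"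
          using elim ln by (simp add: pos_divide_less_eq)
        also have "\<dots> = inverse (real n ^ 2)"
          using elim by (simp add: exp_minus exp_double)
        finally show ?thesis by simp
      qed simp
    qed
    then have "summable (\<lambda>n. norm (a n) * exp (x * l n))"
      by (rule summable_comparison_test_ev) (rule inverse_power_summable, simp)
    then show ?thesis by (subst summable_Suc_iff)
  qed
  ultimately have "dirichlet_series (\<lambda>n. a (Suc n)) (\<lambda>n. l (Suc n)) f"
    using l sums by unfold_locales auto
  then show ?thesis using that by blast
qed

lemma max_modulus_pos_growth:
  assumes "entire_vvds f" "max_modulus f x > 0"
  obtains k where "k > 0" "\<And>y. y > x \<Longrightarrow> max_modulus f x + k * (y - x) \<le> max_modulus f y"
proof -
  obtain a l where "dirichlet_series a l f"
    using assms(1) by (rule entire_vvds_dirichlet_series)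
  then interpret dirichlet_series a l f .
  show ?thesis
    using convex_on_tendsto_0_at_bot_growth[OF convex_max_modulus max_modulus_at_bot assms(2)] that
    by blast
qed

lemma max_modulus_strict_mono:
  assumes "entire_vvds f" "max_modulus f x > 0" "x < y"
  shows "max_modulus f x < max_modulus f y"
proof -
  obtain k where "k > 0" "max_modulus f x + k * (y - x) \<le> max_modulus f y"
    using max_modulus_pos_growth[OF assms(1,2)] assms(3) by metis
  moreover have "k * (y - x) > 0" using \<open>k > 0\<close> assms(3) by simp
  ultimately show ?thesis by linarith
qed

text \<open>A point where \<open>f\<close> does not vanish makes the maximum modulus positive on its
  vertical line; from there on it grows at least linearly.\<close>

lemma filterlim_max_modulus_at_top:
  assumes "entire_vvds f"
  shows "filterlim (max_modulus f) at_top at_top"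
proof -
  obtain a l where "dirichlet_series a l f"
    using assms by (rule entire_vvds_dirichlet_series)
  then interpret dirichlet_series a l f .
  obtain s where "f s \<noteq> 0" using assms by (auto simp: entire_vvds_def)
  define x where "x = Re s"
  have pos: "max_modulus f x > 0"
    using norm_f_le_max_modulus[of s] \<open>f s \<noteq> 0\<close> by (simp add: x_def order.strict_trans2[of 0 "norm (f s)"])
  obtain k where k: "k > 0" "\<And>y. y > x \<Longrightarrow> max_modulus f x + k * (y - x) \<le> max_modulus f y"
    using max_modulus_pos_growth[OF assms pos] by blast
  have "filterlim (\<lambda>y. k * (- x + y)) at_top at_top"
    by (intro filterlim_tendsto_pos_mult_at_top[OF tendsto_const k(1)]
        filterlim_tendsto_add_at_top[OF tendsto_const] filterlim_ident)
  then have "filterlim (\<lambda>y. max_modulus f x + k * (- x + y)) at_top at_top"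
    by (intro filterlim_tendsto_add_at_top[OF tendsto_const])
  then show ?thesis
  proof (rule filterlim_at_top_mono)
    show "eventually (\<lambda>y. max_modulus f x + k * (- x + y) \<le> max_modulus f y) at_top"
      using eventually_gt_at_top[of x] by eventually_elim (use k(2) in \<open>simp add: algebra_simps\<close>)
  qed
qed

lemma max_modulus_surj_pos:
  assumes "entire_vvds f" "y > 0"
  shows "y \<in> range (max_modulus f)"
proof -
  obtain a l where "dirichlet_series a l f"
    using assms(1) by (rule entire_vvds_dirichlet_series)
  then interpret dirichlet_series a l f .
  obtain u where u: "max_modulus f u < y"
    using order_tendstoD(2)[OF max_modulus_at_bot assms(2)] eventually_happens'[OF trivial_limit_at_bot_linorder]
    by blast
  have "eventually (\<lambda>v. y \<le> max_modulus f v \<and> u \<le> v) at_top"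
    using filterlim_max_modulus_at_top[OF assms(1)] eventually_ge_at_top[of u]
    by (intro eventually_conj) (simp_all add: filterlim_at_top)
  then obtain v where "y \<le> max_modulus f v" "u \<le> v"
    using eventually_happens'[OF trivial_limit_at_top_linorder] by blast
  then show ?thesis
    using IVT[of "max_modulus f" u y v] u isCont_max_modulus by auto
qed

section \<open>The inverse of the maximum modulus and the relative modulus\<close>

lemma max_modulus_inv:
  "entire_vvds g \<Longrightarrow> y > 0 \<Longrightarrow> max_modulus g (inv (max_modulus g) y) = y"
  by (rule f_inv_into_f[OF max_modulus_surj_pos])

text \<open>\<open>inv\<close> chooses some preimage. Where the value is positive, strict
  monotonicity excludes every preimage other than \<open>x\<close>, so the choice is forced.\<close>

lemma inv_max_modulus:
  assumes "entire_vvds g" "max_modulus g x > 0"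
  shows "inv (max_modulus g) (max_modulus g x) = x"
proof -
  let ?z = "inv (max_modulus g) (max_modulus g x)"
  have eq: "max_modulus g ?z = max_modulus g x" by (rule max_modulus_inv[OF assms])
  then show ?thesis
    using max_modulus_strict_mono[OF assms(1), of ?z x] max_modulus_strict_mono[OF assms(1), of x ?z] assms(2)
    by (cases ?z x rule: linorder_cases) auto
qed

lemma eventually_max_modulus_pos: "entire_vvds f \<Longrightarrow> eventually (\<lambda>\<sigma>. max_modulus f \<sigma> > 0) at_top"
  using filterlim_max_modulus_at_top by (auto simp: filterlim_at_top_dense)

lemma max_modulus_rel_modulus:
  "entire_vvds g \<Longrightarrow> max_modulus f \<sigma> > 0 \<Longrightarrow> max_modulus g (rel_modulus g f \<sigma>) = max_modulus f \<sigma>"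
  by (simp add: rel_modulus_def max_modulus_inv)

text \<open>The factorization of the growth of \<open>f\<close> relative to \<open>h\<close> through
  \<open>g\<close>: the inner inverse is undone by \<open>max_modulus g\<close>.\<close>

lemma rel_modulus_rel_modulus:
  "entire_vvds g \<Longrightarrow> max_modulus f \<sigma> > 0 \<Longrightarrow> rel_modulus h g (rel_modulus g f \<sigma>) = rel_modulus h f \<sigma>"
  by (simp add: rel_modulus_def[of h] max_modulus_rel_modulus)

lemma rel_modulus_self: "entire_vvds g \<Longrightarrow> max_modulus g x > 0 \<Longrightarrow> rel_modulus g g x = x"
  by (simp add: rel_modulus_def inv_max_modulus)

lemma filterlim_rel_modulus:
  assumes "entire_vvds g" "entire_vvds f"
  shows "filterlim (rel_modulus g f) at_top at_top"
  unfolding filterlim_at_top_dense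
proof
  fix K
  have "eventually (\<lambda>\<sigma>. max_modulus f \<sigma> > max_modulus g K) at_top"
    using filterlim_max_modulus_at_top[OF assms(2)] by (simp add: filterlim_at_top_dense)
  then show "eventually (\<lambda>\<sigma>. rel_modulus g f \<sigma> > K) at_top"
    using eventually_max_modulus_pos[OF assms(2)]
  proof eventually_elim
    case (elim \<sigma>)
    then have "max_modulus g (rel_modulus g f \<sigma>) = max_modulus f \<sigma>"
      by (intro max_modulus_rel_modulus assms)
    then show ?case
      using max_modulus_strict_mono[OF assms(1), of "rel_modulus g f \<sigma>" K] elim
      by (cases "rel_modulus g f \<sigma>" K rule: linorder_cases) auto
  qed
qed

text \<open>\<open>rel_modulus f g\<close> tends to infinity and is eventually a right inverse of
  \<open>rel_modulus g f\<close>. Hence a property that holds eventually along the values of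
  \<open>rel_modulus g f\<close> holds for all large reals.\<close>

lemma filtermap_rel_modulus:
  assumes "entire_vvds g" "entire_vvds f"
  shows "filtermap (rel_modulus g f) at_top = at_top"
proof (rule antisym)
  show "filtermap (rel_modulus g f) at_top \<le> at_top"
    using filterlim_rel_modulus[OF assms] by (simp add: filterlim_def)
  show "at_top \<le> filtermap (rel_modulus g f) at_top"
  proof (rule filter_leI)
    fix P
    assume "eventually P (filtermap (rel_modulus g f) at_top)"
    then have "eventually (\<lambda>x. P (rel_modulus g f (rel_modulus f g x))) at_top"
      by (intro eventually_compose_filterlim[OF _ filterlim_rel_modulus[OF assms(2,1)]])
        (simp add: eventually_filtermap)
    then show "eventually P at_top"
      using eventually_max_modulus_pos[OF assms(1)]
      by eventually_elim (simp add: rel_modulus_rel_modulus rel_modulus_self assms)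
  qed
qed

subsection \<open>Limits inferior and superior of quotients\<close>

lemma Liminf_filtermap: "Liminf (filtermap f F) g = Liminf F (\<lambda>x. g (f x))"
  for g :: "_ \<Rightarrow> 'a::complete_linorder"
  by (intro antisym Liminf_filtermap_le) (simp add: le_Liminf_iff eventually_filtermap less_LiminfD)

lemma Limsup_filtermap: "Limsup (filtermap f F) g = Limsup F (\<lambda>x. g (f x))"
  for g :: "_ \<Rightarrow> 'a::complete_linorder"
  by (intro antisym Limsup_filtermap_ge) (simp add: Limsup_le_iff eventually_filtermap Limsup_lessD)

text \<open>Reduces a bound on a product of limits to finite positive factors \<open>t\<close>,
  which can be pulled out of a limit. For finite \<open>c\<close> this is density of the order; for
  infinite \<open>c\<close> a single \<open>t\<close> forces \<open>L\<close> to be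
  infinite.\<close>

lemma ereal_mult_le_of_less:
  fixes c d L :: ereal
  assumes "0 \<le> c" "0 \<le> L" and le: "\<And>t. 0 < t \<Longrightarrow> ereal t < d \<Longrightarrow> c * ereal t \<le> L"
    and "0 \<le> d"
  shows "c * d \<le> L"
proof (cases "c = 0 \<or> d = 0")
  case False
  then have pos: "c > 0" "d > 0" using assms by auto
  show ?thesis
  proof (cases c)
    case (real r)
    have "d \<le> L / ereal r"
    proof (rule dense_le)
      fix x assume x: "x < d"
      show "x \<le> L / ereal r"
      proof (cases "x \<le> 0")
        case True
        also have "0 \<le> L / ereal r" using assms(2) real pos by (simp add: zero_le_divide_ereal)
        finally show ?thesis .
      next
        case False
        then obtain t where "x = ereal t" "t > 0" using x by (cases x) auto
        then show ?thesis
          using le[of t] x real pos by (simp add: ereal_le_divide_pos)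
      qed
    qed
    then show ?thesis using real pos by (simp add: ereal_le_divide_pos)
  next
    case PInf
    obtain t where t: "0 < ereal t" "ereal t < d" using ereal_dense2[OF pos(2)] by blast
    then have "L = \<infinity>" using le[of t] PInf by simp
    then show ?thesis by simp
  qed (use pos in auto)
qed (use assms in auto)

lemma Liminf_nonneg_ereal: "eventually (\<lambda>x. 0 \<le> u x) F \<Longrightarrow> 0 \<le> Liminf F (u :: _ \<Rightarrow> ereal)"
  by (rule Liminf_bounded)

lemma Limsup_nonneg_ereal:
  "F \<noteq> bot \<Longrightarrow> eventually (\<lambda>x. 0 \<le> u x) F \<Longrightarrow> 0 \<le> Limsup F (u :: _ \<Rightarrow> ereal)"
  by (rule le_Limsup)

text \<open>For every finite positive \<open>t\<close> below the limit inferior of \<open>v\<close>,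
  eventually \<open>u x * t \<le> u x * v x\<close>; then \<open>t\<close> increases to that
  limit.\<close>

lemma
  fixes u v :: "'a \<Rightarrow> ereal"
  assumes F: "F \<noteq> bot" and u: "eventually (\<lambda>x. 0 \<le> u x) F" and v: "eventually (\<lambda>x. 0 \<le> v x) F"
  shows Liminf_mult_Liminf_le_ereal: "Liminf F u * Liminf F v \<le> Liminf F (\<lambda>x. u x * v x)"
    and Limsup_mult_Liminf_le_ereal: "Limsup F u * Liminf F v \<le> Limsup F (\<lambda>x. u x * v x)"
proof -
  have uv: "eventually (\<lambda>x. 0 \<le> u x * v x) F"
    using u v by eventually_elim simp
  have ev: "eventually (\<lambda>x. u x * ereal t \<le> u x * v x) F" if "ereal t < Liminf F v" for t
    using less_LiminfD[OF that] u by eventually_elim (simp add: ereal_mult_left_mono)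
  show "Liminf F u * Liminf F v \<le> Liminf F (\<lambda>x. u x * v x)"
    by (rule ereal_mult_le_of_less[OF Liminf_nonneg_ereal[OF u] Liminf_nonneg_ereal[OF uv] _ Liminf_nonneg_ereal[OF v]])
      (use Liminf_mono[OF ev] in \<open>simp flip: Liminf_ereal_mult_right[OF F]\<close>)
  show "Limsup F u * Liminf F v \<le> Limsup F (\<lambda>x. u x * v x)"
    by (rule ereal_mult_le_of_less[OF Limsup_nonneg_ereal[OF F u] Limsup_nonneg_ereal[OF F uv] _ Liminf_nonneg_ereal[OF v]])
      (use Limsup_mono[OF ev] in \<open>simp flip: Limsup_ereal_mult_right[OF F]\<close>)
qed

text \<open>In \<open>ereal\<close> both 0/0 and \<infinity>/\<infinity> evaluate to 0, while the
  product inequality then puts no bound on \<open>x\<close>; \<open>quotient_ok\<close> excludes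
  exactly these cases.\<close>

lemma le_divide_of_mult_le:
  assumes "x * y \<le> z" "0 \<le> x" "0 \<le> y" "0 \<le> z" "quotient_ok z y"
  shows "x \<le> z / y"
  using assms
  by (cases x; cases y; cases z)
    (auto simp: quotient_ok_def zero_less_mult_iff field_simps split: if_splits)

text \<open>Lower bounds come from the product bounds for \<open>u\<close> and
  \<open>inverse v\<close>, since inversion exchanges limit inferior and superior. Upper bounds come
  from the product bounds for \<open>u / v\<close> and \<open>v\<close>, whose product is
  \<open>u\<close>, followed by division.\<close>

lemma
  fixes u v :: "'a \<Rightarrow> ereal"
  assumes F: "F \<noteq> bot" and u: "eventually (\<lambda>x. 0 < u x \<and> u x < \<infinity>) F"
    and v: "eventually (\<lambda>x. 0 < v x \<and> v x < \<infinity>) F"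
  shows Liminf_divide_Limsup_le: "Liminf F u / Limsup F v \<le> Liminf F (\<lambda>x. u x / v x)"
    and Liminf_divide_Liminf_le: "Liminf F u / Liminf F v \<le> Limsup F (\<lambda>x. u x / v x)"
    and Limsup_divide_Limsup_le: "Limsup F u / Limsup F v \<le> Limsup F (\<lambda>x. u x / v x)"
    and Liminf_divide_le_Liminf:
      "quotient_ok (Liminf F u) (Liminf F v) \<Longrightarrow> Liminf F (\<lambda>x. u x / v x) \<le> Liminf F u / Liminf F v"
    and Liminf_divide_le_Limsup:
      "quotient_ok (Limsup F u) (Limsup F v) \<Longrightarrow> Liminf F (\<lambda>x. u x / v x) \<le> Limsup F u / Limsup F v"
    and Limsup_divide_le:
      "quotient_ok (Limsup F u) (Liminf F v) \<Longrightarrow> Limsup F (\<lambda>x. u x / v x) \<le> Limsup F u / Liminf F v"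
proof -
  have u0: "eventually (\<lambda>x. 0 \<le> u x) F" and v0: "eventually (\<lambda>x. 0 \<le> v x) F"
    using u v by (auto elim: eventually_mono)
  have i0: "eventually (\<lambda>x. 0 \<le> inverse (v x)) F"
    using v0 by eventually_elim (simp add: inverse_ereal_ge0I)
  have q0: "eventually (\<lambda>x. 0 \<le> u x / v x) F"
    using u v by eventually_elim (simp add: zero_le_divide_ereal less_imp_le)
  have uv: "eventually (\<lambda>x. u x / v x * v x = u x) F"
    using u v
  proof eventually_elim
    case (elim x)
    then show ?case by (cases "u x"; cases "v x") auto
  qed
  then have vu: "eventually (\<lambda>x. v x * (u x / v x) = u x) F"
    by (simp only: mult.commute)
  note inv = Liminf_inverse_ereal[OF F v0] Limsup_inverse_ereal[OF F v0]
  show "Liminf F u / Limsup F v \<le> Liminf F (\<lambda>x. u x / v x)"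
    using Liminf_mult_Liminf_le_ereal[OF F u0 i0] by (simp add: divide_ereal_def inv)
  show "Limsup F u / Limsup F v \<le> Limsup F (\<lambda>x. u x / v x)"
    using Limsup_mult_Liminf_le_ereal[OF F u0 i0] by (simp add: divide_ereal_def inv)
  show "Liminf F u / Liminf F v \<le> Limsup F (\<lambda>x. u x / v x)"
    using Limsup_mult_Liminf_le_ereal[OF F i0 u0] by (simp add: divide_ereal_def inv mult.commute)
  note nn = Liminf_nonneg_ereal[OF u0] Liminf_nonneg_ereal[OF v0] Liminf_nonneg_ereal[OF q0]
    Limsup_nonneg_ereal[OF F u0] Limsup_nonneg_ereal[OF F v0] Limsup_nonneg_ereal[OF F q0]
  show "Liminf F (\<lambda>x. u x / v x) \<le> Liminf F u / Liminf F v" if "quotient_ok (Liminf F u) (Liminf F v)"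
    using Liminf_mult_Liminf_le_ereal[OF F q0 v0, unfolded Liminf_eq[OF uv]] that nn
    by (intro le_divide_of_mult_le)
  show "Limsup F (\<lambda>x. u x / v x) \<le> Limsup F u / Liminf F v" if "quotient_ok (Limsup F u) (Liminf F v)"
    using Limsup_mult_Liminf_le_ereal[OF F q0 v0, unfolded Limsup_eq[OF uv]] that nn
    by (intro le_divide_of_mult_le)
  show "Liminf F (\<lambda>x. u x / v x) \<le> Limsup F u / Limsup F v" if "quotient_ok (Limsup F u) (Limsup F v)"
    using Limsup_mult_Liminf_le_ereal[OF F v0 q0, unfolded Limsup_eq[OF vu]] that nn
    by (intro le_divide_of_mult_le) (simp_all add: mult.commute)
qed

definition ereal_powr :: "ereal \<Rightarrow> real \<Rightarrow> ereal"
  where "ereal_powr x s = (if x = \<infinity> then \<infinity> else ereal (real_of_ereal x powr s))"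

lemma quotient_root_eq: "quotient_root a b r = ereal_powr (a / b) (1 / real_of_ereal r)"
  by (simp add: quotient_root_def ereal_powr_def)

lemma ereal_powr_nonneg: "0 \<le> ereal_powr x s"
  by (simp add: ereal_powr_def)

lemma ereal_powr_strict_mono: "0 \<le> x \<Longrightarrow> x < y \<Longrightarrow> 0 < s \<Longrightarrow> ereal_powr x s < ereal_powr y s"
  by (cases x; cases y) (auto simp: ereal_powr_def powr_less_mono2)

lemma ereal_powr_mono: "0 \<le> x \<Longrightarrow> x \<le> y \<Longrightarrow> 0 < s \<Longrightarrow> ereal_powr x s \<le> ereal_powr y s"
  using ereal_powr_strict_mono[of x y s] by (cases "x = y") (auto intro: less_imp_le)

lemma ereal_powr_inverse: "0 \<le> x \<Longrightarrow> 0 < s \<Longrightarrow> ereal_powr (ereal_powr x (1 / s)) s = x"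
  by (cases x) (auto simp: ereal_powr_def powr_powr)

lemma
  fixes u :: "'a \<Rightarrow> ereal"
  assumes F: "F \<noteq> bot" and u: "eventually (\<lambda>x. 0 \<le> u x) F" and s: "0 < s"
  shows Liminf_ereal_powr: "Liminf F (\<lambda>x. ereal_powr (u x) s) = ereal_powr (Liminf F u) s"
    and Limsup_ereal_powr: "Limsup F (\<lambda>x. ereal_powr (u x) s) = ereal_powr (Limsup F u) s"
proof -
  have lower: "ereal_powr (Liminf F u) s \<le> Liminf F (\<lambda>x. ereal_powr (u x) s)"
    if u: "eventually (\<lambda>x. 0 \<le> u x) F" and s: "0 < s" for u :: "'a \<Rightarrow> ereal" and s
    unfolding le_Liminf_iff
  proof (intro allI impI)
    fix y assume y: "y < ereal_powr (Liminf F u) s"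
    show "eventually (\<lambda>x. y < ereal_powr (u x) s) F"
    proof (cases "y < 0")
      case True
      then show ?thesis by (simp add: less_le_trans[OF _ ereal_powr_nonneg])
    next
      case False
      define z where "z = ereal_powr y (1 / s)"
      have z: "0 \<le> z" "ereal_powr z s = y"
        using False s by (simp_all add: z_def ereal_powr_nonneg ereal_powr_inverse)
      then have "z < Liminf F u"
        using y ereal_powr_mono[OF Liminf_nonneg_ereal[OF u] _ s, of z] by (metis not_le)
      from less_LiminfD[OF this] show ?thesis
        by eventually_elim (use ereal_powr_strict_mono[OF z(1) _ s] z(2) in auto)
    qed
  qed
  have upper: "Limsup F (\<lambda>x. ereal_powr (u x) s) \<le> ereal_powr (Limsup F u) s"
    if u: "eventually (\<lambda>x. 0 \<le> u x) F" and s: "0 < s" for u :: "'a \<Rightarrow> ereal" and s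
    unfolding Limsup_le_iff
  proof (intro allI impI)
    fix y assume y: "ereal_powr (Limsup F u) s < y"
    define z where "z = ereal_powr y (1 / s)"
    have "0 \<le> y" using y ereal_powr_nonneg[of "Limsup F u" s] by simp
    then have z: "0 \<le> z" "ereal_powr z s = y"
      using s by (simp_all add: z_def ereal_powr_nonneg ereal_powr_inverse)
    then have "Limsup F u < z"
      using y ereal_powr_mono[OF z(1) _ s, of "Limsup F u"] by (metis not_le)
    from Limsup_lessD[OF this] u show "eventually (\<lambda>x. ereal_powr (u x) s < y) F"
      by eventually_elim (use ereal_powr_strict_mono[OF _ _ s] z(2) in blast)
  qed
  define w where "w x = ereal_powr (u x) s" for x
  have w: "eventually (\<lambda>x. 0 \<le> w x) F" by (simp add: w_def ereal_powr_nonneg)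
  have wu: "eventually (\<lambda>x. ereal_powr (w x) (1 / s) = u x) F"
    using u by eventually_elim (use ereal_powr_inverse[of _ "1 / s"] s in \<open>simp add: w_def\<close>)
  have "ereal_powr (Liminf F w) (1 / s) \<le> Liminf F u"
    using lower[OF w, of "1 / s"] s by (simp add: Liminf_eq[OF wu])
  from ereal_powr_mono[OF ereal_powr_nonneg this s]
  have "Liminf F w \<le> ereal_powr (Liminf F u) s"
    by (simp add: ereal_powr_inverse[OF Liminf_nonneg_ereal[OF w] s])
  with lower[OF u s] show "Liminf F (\<lambda>x. ereal_powr (u x) s) = ereal_powr (Liminf F u) s"
    by (simp add: w_def[abs_def])
  have "Limsup F u \<le> ereal_powr (Limsup F w) (1 / s)"
    using upper[OF w, of "1 / s"] s by (simp add: Limsup_eq[OF wu])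
  from ereal_powr_mono[OF Limsup_nonneg_ereal[OF F u] this s]
  have "ereal_powr (Limsup F u) s \<le> Limsup F w"
    by (simp add: ereal_powr_inverse[OF Limsup_nonneg_ereal[OF F w] s])
  with upper[OF u s] show "Limsup F (\<lambda>x. ereal_powr (u x) s) = ereal_powr (Limsup F u) s"
    by (simp add: w_def[abs_def])
qed

subsection \<open>Relative orders and types\<close>

lemma filterlim_iter_log: "filterlim (iter_log k) at_top at_top"
proof -
  have "filterlim (f ^^ n) at_top at_top" if "filterlim f at_top at_top" for n and f :: "real \<Rightarrow> real"
    by (induction n) (auto simp: filterlim_ident id_def o_def intro: filterlim_compose[OF that])
  then have "filterlim (ln ^^ nat k :: real \<Rightarrow> real) at_top at_top"
    "filterlim (exp ^^ nat (- k) :: real \<Rightarrow> real) at_top at_top"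
    using ln_at_top exp_at_top by blast+
  then show ?thesis
    by (cases "0 \<le> k") (simp_all add: iter_log_def[abs_def])
qed

lemma eventually_iter_log_pos:
  assumes "filterlim R at_top F"
  shows "eventually (\<lambda>\<sigma>. iter_log k (R \<sigma>) > 0) F"
  using filterlim_compose[OF filterlim_iter_log assms] by (auto simp: filterlim_at_top_dense)

lemma
  assumes "entire_vvds f" "entire_vvds g" "entire_vvds h"
    and "rel_lower_order h f m q = rel_order h f m q" "pos_finite (rel_order h f m q)"
  shows rel_lower_order_eq_divide:
      "pos_finite (rel_order h g m p) \<Longrightarrow> rel_lower_order g f p q = rel_order h f m q / rel_order h g m p"
    and rel_order_eq_divide:
      "pos_finite (rel_lower_order h g m p) \<Longrightarrow> rel_order g f p q = rel_order h f m q / rel_lower_order h g m p"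
proof -
  define u where "u \<sigma> = ereal (iter_log m (rel_modulus h f \<sigma>) / iter_log q \<sigma>)" for \<sigma>
  define b where "b \<sigma> = ereal (iter_log m (rel_modulus h g \<sigma>) / iter_log p \<sigma>)" for \<sigma>
  define R where "R = rel_modulus g f"
  have R: "filtermap R at_top = at_top" "filterlim R at_top at_top"
    unfolding R_def using assms by (simp_all add: filtermap_rel_modulus filterlim_rel_modulus)
  note evs = eventually_max_modulus_pos[OF assms(1)] eventually_iter_log_pos[OF filterlim_ident]
    eventually_iter_log_pos[OF R(2)] eventually_iter_log_pos[OF filterlim_rel_modulus[OF assms(3,1)]]
    eventually_iter_log_pos[OF filterlim_rel_modulus[OF assms(3,2)]]
  have eq: "eventually (\<lambda>\<sigma>. ereal (iter_log p (rel_modulus g f \<sigma>) / iter_log q \<sigma>) = u \<sigma> / b (R \<sigma>)) at_top"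
    using evs(1) evs(2)[of q] evs(3)[of p] evs(4)[of m]
    by eventually_elim
      (simp add: u_def b_def R_def rel_modulus_rel_modulus assms field_simps)
  have u: "eventually (\<lambda>\<sigma>. 0 < u \<sigma> \<and> u \<sigma> < \<infinity>) at_top"
    using evs(2)[of q] evs(4)[of m] by eventually_elim (simp add: u_def)
  have b: "eventually (\<lambda>\<sigma>. 0 < b \<sigma> \<and> b \<sigma> < \<infinity>) at_top"
    using evs(2)[of p] evs(5)[of m] by eventually_elim (simp add: b_def)
  then have bR: "eventually (\<lambda>\<sigma>. 0 < b (R \<sigma>) \<and> b (R \<sigma>) < \<infinity>) at_top"
    by (subst (asm) R(1)[symmetric]) (simp add: eventually_filtermap)
  have [simp]: "Liminf at_top (\<lambda>\<sigma>. b (R \<sigma>)) = rel_lower_order h g m p"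
    "Limsup at_top (\<lambda>\<sigma>. b (R \<sigma>)) = rel_order h g m p"
    using Liminf_filtermap[of R at_top b] Limsup_filtermap[of R at_top b]
    by (simp_all add: R rel_lower_order_def rel_order_def b_def[abs_def])
  have [simp]: "Liminf at_top u = rel_order h f m q" "Limsup at_top u = rel_order h f m q"
    using assms(4) by (simp_all add: u_def[abs_def] rel_order_def rel_lower_order_def)
  have ok: "quotient_ok (rel_order h f m q) x" if "pos_finite x" for x
    using assms(5) by (auto simp: quotient_ok_def pos_finite_def)
  note bounds = trivial_limit_at_top_linorder u bR
  show "rel_lower_order g f p q = rel_order h f m q / rel_order h g m p"
    if "pos_finite (rel_order h g m p)"
    using Liminf_divide_Limsup_le[OF bounds] Liminf_divide_le_Limsup[OF bounds] ok[OF that]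
    by (simp add: rel_lower_order_def Liminf_eq[OF eq])
  show "rel_order g f p q = rel_order h f m q / rel_lower_order h g m p"
    if "pos_finite (rel_lower_order h g m p)"
    using Liminf_divide_Liminf_le[OF bounds] Limsup_divide_le[OF bounds] ok[OF that]
    by (simp add: rel_order_def[of g] Limsup_eq[OF eq])
qed

lemma type_quotient_bounds:
  fixes f :: "complex \<Rightarrow> 'a::complex_banach"
    and g :: "complex \<Rightarrow> 'b::complex_banach"
    and h :: "complex \<Rightarrow> 'c::complex_banach"
    and p q m :: int and \<alpha> \<beta> :: ereal
  assumes "entire_vvds f" "entire_vvds g" "entire_vvds h" "pos_finite \<alpha>" "pos_finite \<beta>"
  defines "a \<equiv> type_quotient h f m q \<alpha>"
    and "b \<equiv> type_quotient h g m p \<beta>"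
    and "c \<equiv> type_quotient g f p q (\<alpha> / \<beta>)"
  shows "quotient_root (Liminf at_top a) (Limsup at_top b) \<beta> \<le> Liminf at_top c" (is ?A)
    and "quotient_ok (Liminf at_top a) (Liminf at_top b) \<Longrightarrow>
      Liminf at_top c \<le> quotient_root (Liminf at_top a) (Liminf at_top b) \<beta>" (is "_ \<Longrightarrow> ?B")
    and "quotient_ok (Limsup at_top a) (Limsup at_top b) \<Longrightarrow>
      Liminf at_top c \<le> quotient_root (Limsup at_top a) (Limsup at_top b) \<beta>" (is "_ \<Longrightarrow> ?C")
    and "quotient_root (Liminf at_top a) (Liminf at_top b) \<beta> \<le> Limsup at_top c" (is ?D)
    and "quotient_root (Limsup at_top a) (Limsup at_top b) \<beta> \<le> Limsup at_top c" (is ?E)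
    and "quotient_ok (Limsup at_top a) (Liminf at_top b) \<Longrightarrow>
      Limsup at_top c \<le> quotient_root (Limsup at_top a) (Liminf at_top b) \<beta>" (is "_ \<Longrightarrow> ?F")
proof -
  obtain x y where x: "\<alpha> = ereal x" "x > 0" and y: "\<beta> = ereal y" "y > 0"
    using assms(4,5) by (cases \<alpha>; cases \<beta>) (auto simp: pos_finite_def)
  define R where "R = rel_modulus g f"
  have R: "filtermap R at_top = at_top" "filterlim R at_top at_top"
    unfolding R_def using assms by (simp_all add: filtermap_rel_modulus filterlim_rel_modulus)
  note evs = eventually_max_modulus_pos[OF assms(1)] eventually_iter_log_pos[OF filterlim_ident]
    eventually_iter_log_pos[OF R(2)] eventually_iter_log_pos[OF filterlim_rel_modulus[OF assms(3,1)]]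
    eventually_iter_log_pos[OF filterlim_rel_modulus[OF assms(3,2)]]
  have eq: "eventually (\<lambda>\<sigma>. c \<sigma> = ereal_powr (a \<sigma> / b (R \<sigma>)) (1 / y)) at_top"
    using evs(1) evs(2)[of "q - 1"] evs(3)[of "p - 1"] evs(4)[of "m - 1"]
  proof eventually_elim
    case (elim \<sigma>)
    define X where "X = iter_log (p - 1) (R \<sigma>)"
    define Y where "Y = iter_log (q - 1) \<sigma>"
    define Z where "Z = iter_log (m - 1) (rel_modulus h f \<sigma>)"
    have pos: "X > 0" "Y > 0" "Z > 0" using elim by (simp_all add: X_def Y_def Z_def)
    have "a \<sigma> / b (R \<sigma>) = ereal ((Z / Y powr x) / (Z / X powr y))"
      using elim pos assms(2)
      by (simp add: a_def b_def type_quotient_def x y X_def Y_def Z_def R_def rel_modulus_rel_modulus)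
    also have "(Z / Y powr x) / (Z / X powr y) = X powr y / Y powr x"
      using pos by (simp add: field_simps)
    finally have "ereal_powr (a \<sigma> / b (R \<sigma>)) (1 / y) = ereal (X / Y powr (x / y))"
      using pos y by (simp add: ereal_powr_def powr_divide powr_powr)
    also have "\<dots> = c \<sigma>"
      using x y by (simp add: c_def type_quotient_def X_def Y_def R_def)
    finally show ?case ..
  qed
  have a: "eventually (\<lambda>\<sigma>. 0 < a \<sigma> \<and> a \<sigma> < \<infinity>) at_top"
    using evs(2)[of "q - 1"] evs(4)[of "m - 1"]
    by eventually_elim (simp add: a_def type_quotient_def)
  have b: "eventually (\<lambda>\<sigma>. 0 < b \<sigma> \<and> b \<sigma> < \<infinity>) at_top"
    using evs(2)[of "p - 1"] evs(5)[of "m - 1"]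
    by eventually_elim (simp add: b_def type_quotient_def)
  then have bR: "eventually (\<lambda>\<sigma>. 0 < b (R \<sigma>) \<and> b (R \<sigma>) < \<infinity>) at_top"
    by (subst (asm) R(1)[symmetric]) (simp add: eventually_filtermap)
  have q0: "eventually (\<lambda>\<sigma>. 0 \<le> a \<sigma> / b (R \<sigma>)) at_top"
    using a bR by eventually_elim (simp add: zero_le_divide_ereal less_imp_le)
  have [simp]: "Liminf at_top (\<lambda>\<sigma>. b (R \<sigma>)) = Liminf at_top b"
    "Limsup at_top (\<lambda>\<sigma>. b (R \<sigma>)) = Limsup at_top b"
    using Liminf_filtermap[of R at_top b] Limsup_filtermap[of R at_top b] by (simp_all add: R)
  have nn: "0 \<le> Liminf at_top a" "0 \<le> Limsup at_top a" "0 \<le> Liminf at_top b" "0 \<le> Limsup at_top b"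
    using a b by (auto intro!: Liminf_nonneg_ereal Limsup_nonneg_ereal elim: eventually_mono)
  have y': "1 / y > 0" using y by simp
  define Q where "Q \<sigma> = a \<sigma> / b (R \<sigma>)" for \<sigma>
  have c: "Liminf at_top c = ereal_powr (Liminf at_top Q) (1 / y)"
    "Limsup at_top c = ereal_powr (Limsup at_top Q) (1 / y)"
    using Liminf_ereal_powr[OF _ q0 y'] Limsup_ereal_powr[OF _ q0 y']
    by (simp_all add: Liminf_eq[OF eq] Limsup_eq[OF eq] Q_def[abs_def])
  have Q0: "0 \<le> Liminf at_top Q" "0 \<le> Limsup at_top Q"
    using q0 by (auto simp: Q_def intro!: Liminf_nonneg_ereal Limsup_nonneg_ereal)
  note bounds = trivial_limit_at_top_linorder a bR
  note pm = ereal_powr_mono[OF _ _ y']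
  note D = zero_le_divide_ereal
  show ?A using Liminf_divide_Limsup_le[OF bounds] nn
    by (simp add: c quotient_root_eq y Q_def[abs_def] pm D)
  show ?B if "quotient_ok (Liminf at_top a) (Liminf at_top b)"
    using Liminf_divide_le_Liminf[OF bounds] that Q0
    by (simp add: c quotient_root_eq y Q_def[abs_def] pm)
  show ?C if "quotient_ok (Limsup at_top a) (Limsup at_top b)"
    using Liminf_divide_le_Limsup[OF bounds] that Q0
    by (simp add: c quotient_root_eq y Q_def[abs_def] pm)
  show ?D using Liminf_divide_Liminf_le[OF bounds] nn
    by (simp add: c quotient_root_eq y Q_def[abs_def] pm D)
  show ?E using Limsup_divide_Limsup_le[OF bounds] nn
    by (simp add: c quotient_root_eq y Q_def[abs_def] pm D)
  show ?F if "quotient_ok (Limsup at_top a) (Liminf at_top b)"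
    using Limsup_divide_le[OF bounds] that Q0
    by (simp add: c quotient_root_eq y Q_def[abs_def] pm)
qed

theorem theorem7:
  fixes f :: "complex \<Rightarrow> 'a::complex_banach"
    and g :: "complex \<Rightarrow> 'b::complex_banach"
    and h :: "complex \<Rightarrow> 'c::complex_banach"
    and p q m :: int
  assumes "0 \<le> p" "0 \<le> q" "0 \<le> m"
    and "entire_vvds f" "entire_vvds g" "entire_vvds h"
    and "has_rel_index_pair h f m q"
    and "has_rel_index_pair h g m p"
    and "rel_lower_order h f m q = rel_order h f m q"
  shows
    "(pos_finite (rel_order h f m q) \<and> pos_finite (rel_order h g m p) \<and>
      pos_finite (rel_lower_order g f p q) \<longrightarrow>
        (quotient_ok (rel_lower_type h f m q) (rel_type h g m p) \<longrightarrow>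
          quotient_root (rel_lower_type h f m q) (rel_type h g m p) (rel_order h g m p)
          \<le> rel_weak_type g f p q) \<and>
        (quotient_ok (rel_lower_type h f m q) (rel_lower_type h g m p) \<and>
         quotient_ok (rel_type h f m q) (rel_type h g m p) \<longrightarrow>
          rel_weak_type g f p q
          \<le> min (quotient_root (rel_lower_type h f m q) (rel_lower_type h g m p) (rel_order h g m p))
                (quotient_root (rel_type h f m q) (rel_type h g m p) (rel_order h g m p)) \<and>
          min (quotient_root (rel_lower_type h f m q) (rel_lower_type h g m p) (rel_order h g m p))
              (quotient_root (rel_type h f m q) (rel_type h g m p) (rel_order h g m p))
          \<le> max (quotient_root (rel_lower_type h f m q) (rel_lower_type h g m p) (rel_order h g m p))
                (quotient_root (rel_type h f m q) (rel_type h g m p) (rel_order h g m p)) \<and>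
          max (quotient_root (rel_lower_type h f m q) (rel_lower_type h g m p) (rel_order h g m p))
              (quotient_root (rel_type h f m q) (rel_type h g m p) (rel_order h g m p))
          \<le> rel_upper_weak_type g f p q) \<and>
        (quotient_ok (rel_type h f m q) (rel_lower_type h g m p) \<longrightarrow>
          rel_upper_weak_type g f p q
          \<le> quotient_root (rel_type h f m q) (rel_lower_type h g m p) (rel_order h g m p)))
     \<and>
     (pos_finite (rel_lower_order h f m q) \<and> pos_finite (rel_lower_order h g m p) \<and>
      pos_finite (rel_order g f p q) \<longrightarrow>
        (quotient_ok (rel_weak_type h f m q) (rel_upper_weak_type h g m p) \<longrightarrow>
          quotient_root (rel_weak_type h f m q) (rel_upper_weak_type h g m p) (rel_lower_order h g m p)
          \<le> rel_lower_type g f p q) \<and>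
        (quotient_ok (rel_weak_type h f m q) (rel_weak_type h g m p) \<and>
         quotient_ok (rel_upper_weak_type h f m q) (rel_upper_weak_type h g m p) \<longrightarrow>
          rel_lower_type g f p q
          \<le> min (quotient_root (rel_weak_type h f m q) (rel_weak_type h g m p) (rel_lower_order h g m p))
                (quotient_root (rel_upper_weak_type h f m q) (rel_upper_weak_type h g m p) (rel_lower_order h g m p)) \<and>
          min (quotient_root (rel_weak_type h f m q) (rel_weak_type h g m p) (rel_lower_order h g m p))
              (quotient_root (rel_upper_weak_type h f m q) (rel_upper_weak_type h g m p) (rel_lower_order h g m p))
          \<le> max (quotient_root (rel_weak_type h f m q) (rel_weak_type h g m p) (rel_lower_order h g m p))
                (quotient_root (rel_upper_weak_type h f m q) (rel_upper_weak_type h g m p) (rel_lower_order h g m p)) \<and>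
          max (quotient_root (rel_weak_type h f m q) (rel_weak_type h g m p) (rel_lower_order h g m p))
              (quotient_root (rel_upper_weak_type h f m q) (rel_upper_weak_type h g m p) (rel_lower_order h g m p))
          \<le> rel_type g f p q) \<and>
        (quotient_ok (rel_upper_weak_type h f m q) (rel_weak_type h g m p) \<longrightarrow>
          rel_type g f p q
          \<le> quotient_root (rel_upper_weak_type h f m q) (rel_weak_type h g m p) (rel_lower_order h g m p)))"
proof (intro conjI[of "_ \<longrightarrow> _" "_ \<longrightarrow> _"] impI, goal_cases)
  case 1
  then have *: "rel_lower_order g f p q = rel_order h f m q / rel_order h g m p"
    using assms by (intro rel_lower_order_eq_divide) auto
  have types: "rel_weak_type g f p q
      = Liminf at_top (type_quotient g f p q (rel_order h f m q / rel_order h g m p))"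
    "rel_upper_weak_type g f p q
      = Limsup at_top (type_quotient g f p q (rel_order h f m q / rel_order h g m p))"
    by (simp_all add: rel_weak_type_def rel_upper_weak_type_def *)
  note bounds = type_quotient_bounds[of f g h "rel_order h f m q" "rel_order h g m p" m q p,
      folded types rel_type_def rel_lower_type_def]
  from 1 assms bounds show ?case
    by (auto intro: order.trans[OF min.cobounded1 max.cobounded1])
next
  case 2
  then have *: "rel_order g f p q = rel_lower_order h f m q / rel_lower_order h g m p"
    using assms rel_order_eq_divide[of f g h m q p] by auto
  have types: "rel_lower_type g f p q
      = Liminf at_top (type_quotient g f p q (rel_lower_order h f m q / rel_lower_order h g m p))"
    "rel_type g f p q
      = Limsup at_top (type_quotient g f p q (rel_lower_order h f m q / rel_lower_order h g m p))"
    by (simp_all add: rel_type_def rel_lower_type_def *)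
  note bounds = type_quotient_bounds[of f g h "rel_lower_order h f m q" "rel_lower_order h g m p" m q p,
      folded types rel_weak_type_def rel_upper_weak_type_def]
  from 2 assms bounds show ?case
    by (auto intro: order.trans[OF min.cobounded1 max.cobounded1])
qed

end
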